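(* Let $a,b,d\in\mathbb{R}$, let $q$ be an indeterminate, and suppose that the sequence of polynomials $\{T_n(q)\}_{n\geqslant 0}$ in $q$ has exponential generating function $$\sum_{n\geqslant 0}\frac{T_n(q)}{n!}x^n=\left(\frac{(1-q)e^{a(1-q)x}}{1-q e^{d(1-q)x}}\right)^b .$$ Then the ordinary generating function of $\{T_n(q)\}_{n\geqslant0}$ is given by the continued fraction $$\sum_{n\geqslant 0}T_n(q)x^n=\cfrac{1}{1-s_0(q)x-\cfrac{t_1(q)x^2}{1-s_1(q)x-\cfrac{t_2(q)x^2}{1-s_2(q)x-\cfrac{t_3(q)x^2}{1-s_3(q)x-\cdots}}}},$$ where, for all $i\geqslant 0$, $$s_i(q)=(di+ab)+(di+bd-ab)q\quad\text{and}\quad t_{i+1}(q)=d^2(i+1)(i+b)q .$$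
   Context: All generating functions are formal power series in $x$ with coefficients in $\mathbb{R}(q)$. The base of the $b$-th power has constant term $1$ in $x$, so its real power $b$ is defined as a formal power series (e.g. $F^b=\exp(b\log F)$). The infinite continued fraction is understood as the limit, in the $x$-adic topology on formal power series, of its finite truncations. *)

theory Defs
  imports Complex_Main "HOL-Computational_Algebra.Computational_Algebra"
begin

type_synonym ratfun = "real poly fract"

definition ratfun_const :: "real \<Rightarrow> ratfun"
  where "ratfun_const c = to_fract [:c:]"

definition ratfun_q :: ratfun
  where "ratfun_q = to_fract [:0, 1:]"

text \<open>
  The power \<open>F\<^sup>b = exp (b log F)\<close> for a power series \<open>F\<close> with constant term 1; other \<open>F\<close> are
  outside the intended domain. Note that \<^term>\<open>fps_ln 1\<close> is the series of \<open>log (1 + x)\<close>,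
  whence the composition with \<open>F - 1\<close>.
\<close>

definition fps_real_power :: "ratfun fps \<Rightarrow> real \<Rightarrow> ratfun fps"
  where "fps_real_power F b =
    fps_exp 1 oo (fps_const (ratfun_const b) * (fps_ln 1 oo (F - 1)))"

text \<open>
  \<open>jfrac s t n k\<close> is the truncation to \<open>n\<close> levels of the Jacobi continued fraction whose top
  level is \<open>1 / (1 - s k x - t (k + 1) x\<^sup>2 / \<dots>)\<close>; the part below the last level is replaced
  by 0. The value \<open>t 0\<close> is never used.
\<close>

fun jfrac :: "(nat \<Rightarrow> 'a::field) \<Rightarrow> (nat \<Rightarrow> 'a) \<Rightarrow> nat \<Rightarrow> nat \<Rightarrow> 'a fps"
  where
    "jfrac s t 0 k = 0"
  | "jfrac s t (Suc n) k =
      1 / (1 - fps_const (s k) * fps_X - fps_const (t (Suc k)) * fps_X ^ 2 * jfrac s t n (Suc k))"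

text \<open>
  The infinite continued fraction is the limit of \<open>jfrac s t n 0\<close> as \<open>n\<close> tends to infinity. The
  library's metric on formal power series induces the \<open>x\<close>-adic topology, so plain sequence
  convergence in \<^typ>\<open>'a fps\<close> expresses this; limits are unique.
\<close>

abbreviation has_jfraction :: "'a::field fps \<Rightarrow> (nat \<Rightarrow> 'a) \<Rightarrow> (nat \<Rightarrow> 'a) \<Rightarrow> bool"
  where "has_jfraction F s t \<equiv> (\<lambda>n. jfrac s t n 0) \<longlonglongrightarrow> F"

end

theory Submission
  imports Defs
begin

text \<open>
  Both sides are governed by the same infinite tridiagonal array.

  Let \<open>F\<close> be the base of the power and \<open>G = F\<^sup>b\<close>. The logarithmic derivative of \<open>F\<close> is an affine
  function of a series \<open>W\<close> with zero constant term that solves a Riccati equation with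
  constant coefficients (\<open>log_deriv_base_affine\<close>):
  \<open>F'/F = a (1 - q) + d q + d\<^sup>2 q W\<close> and \<open>W' = (1 + d W) (1 + d q W)\<close>.
  Taking the \<open>b\<close>-th power multiplies the logarithmic derivative by \<open>b\<close>
  (\<open>fps_deriv_real_power\<close>), so \<open>G'/G\<close> is affine in \<open>W\<close> as well.

  Because \<open>G'/G\<close> has degree 1 and \<open>W'\<close> degree 2 in \<open>W\<close>, differentiating
  \<open>C\<^sub>k = G W\<^sup>k / k!\<close> yields a combination of \<open>C\<^bsub>k-1\<^esub>\<close>, \<open>C\<^sub>k\<close> and \<open>C\<^bsub>k+1\<^esub>\<close> only, the first with
  coefficient 1; the other two coefficients are exactly \<open>s\<^sub>k\<close> and \<open>t\<^bsub>k+1\<^esub>\<close>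
  (\<open>has_jfraction_riordan\<close>). Hence the numbers \<open>M\<^bsub>n,k\<^esub> = n! [x\<^sup>n] C\<^sub>k\<close> satisfy the recurrence that
  counts weighted Motzkin paths of length \<open>n\<close> ending at height \<open>k\<close>, and their column \<open>k = 0\<close>
  is \<open>T\<^sub>n\<close>. That column 0 of such an array has a Jacobi fraction as its ordinary generating
  function is Flajolet's theorem; here it is derived (\<open>has_jfraction_array\<close>) from a three-term
  recurrence between the generating functions of the columns, by the method of Euler and Gauss.
\<close>

section \<open>Jacobi continued fractions from three-term recurrences\<close>

text \<open>
  Formally, the recurrence says that the ratio \<open>E\<^bsub>k+1\<^esub>/E\<^sub>k\<close> is the tail of the continued
  fraction from level \<open>k\<close> on. Cleared of denominators, the error of a truncation is \<open>x\<^sup>2\<close> times a multiple of the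
  error at the next level of the truncation that is one level shorter.
\<close>

lemma jfrac_error_dvd:
  fixes E :: "nat \<Rightarrow> 'a::field fps"
  assumes "\<And>k. E (Suc k) = E k + fps_const (s k) * fps_X * E (Suc k)
    + fps_const (t (Suc k)) * fps_X ^ 2 * E (Suc (Suc k))"
  shows "fps_X ^ (2 * n) dvd E (Suc k) - jfrac s t n k * E k"
proof (induction n arbitrary: k)
  case 0
  show ?case by simp
next
  case (Suc n)
  define J where "J = jfrac s t n (Suc k)"
  define U where "U = 1 - fps_const (s k) * fps_X - fps_const (t (Suc k)) * fps_X ^ 2 * J"
  \<comment> \<open>\<open>1/U\<close> is the truncation itself; \<open>U\<close> is a unit because its constant term is 1.\<close>
  define J' where "J' = jfrac s t (Suc n) k"
  have "U $ 0 = 1"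
    by (simp add: U_def fps_mult_nth power2_eq_square)
  then have inv: "J' * U = 1"
    using inverse_mult_eq_1[of U] by (simp add: J'_def U_def J_def fps_divide_unit)
  have "E k = U * E (Suc k) - fps_const (t (Suc k)) * fps_X ^ 2 * (E (Suc (Suc k)) - J * E (Suc k))"
    using assms[of k] by (simp add: U_def algebra_simps)
  then have "J' * E k = (J' * U) * E (Suc k)
      - J' * (fps_const (t (Suc k)) * fps_X ^ 2 * (E (Suc (Suc k)) - J * E (Suc k)))"
    by (metis right_diff_distrib mult.assoc)
  then have "E (Suc k) - J' * E k
      = fps_const (t (Suc k)) * J' * (fps_X ^ 2 * (E (Suc (Suc k)) - J * E (Suc k)))"
    by (simp add: inv algebra_simps)
  moreover have "fps_X ^ (2 * Suc n) dvd fps_X ^ 2 * (E (Suc (Suc k)) - J * E (Suc k))"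
    using Suc.IH[of "Suc k"] unfolding J_def mult_Suc_right power_add
    by (rule mult_dvd_mono[OF dvd_refl])
  ultimately show ?case
    by (metis J'_def dvd_mult)
qed

lemma has_jfraction_three_term:
  fixes E :: "nat \<Rightarrow> 'a::field fps"
  assumes "E 0 = 1"
    and "\<And>k. E (Suc k) = E k + fps_const (s k) * fps_X * E (Suc k)
      + fps_const (t (Suc k)) * fps_X ^ 2 * E (Suc (Suc k))"
  shows "has_jfraction (E 1) s t"
proof (rule tendsto_fpsI)
  fix m
  have "jfrac s t n 0 $ m = E 1 $ m" if "n > m" for n
  proof -
    have "fps_X ^ (2 * n) dvd E 1 - jfrac s t n 0"
      using jfrac_error_dvd[of E s t n 0] assms by simp
    then obtain h where "E 1 - jfrac s t n 0 = fps_X ^ (2 * n) * h"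
      by (elim dvdE)
    then have "(E 1 - jfrac s t n 0) $ m = 0"
      using that by (simp only: fps_X_power_mult_nth) simp
    then show ?thesis
      by simp
  qed
  then show "eventually (\<lambda>n. jfrac s t n 0 $ m = E 1 $ m) sequentially"
    by (intro eventually_mono[OF eventually_gt_at_top[of m]])
qed

text \<open>
  The entry \<open>M n k\<close> is the total weight of the Motzkin paths of length \<open>n\<close> from height 0 to
  height \<open>k\<close>, with weight 1 on rises, \<open>s\<close> on level steps and \<open>t\<close> on falls. Reaching height
  \<open>k\<close> takes at least \<open>k\<close> steps, so the generating function of column \<open>k\<close> is divisible by
  \<open>x\<^sup>k\<close>; after division by \<open>x\<^sup>k\<close> the columns satisfy the three-term recurrence, with the
  constant 1 standing in for a column \<open>-1\<close> that accounts for the empty path.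
\<close>

lemma has_jfraction_array:
  fixes M :: "nat \<Rightarrow> nat \<Rightarrow> 'a::field"
  assumes M00: "M 0 0 = 1"
    and M0: "\<And>k. M 0 (Suc k) = 0"
    and first: "\<And>n. M (Suc n) 0 = s 0 * M n 0 + t 1 * M n 1"
    and step: "\<And>n k. M (Suc n) (Suc k)
      = M n k + s (Suc k) * M n (Suc k) + t (Suc (Suc k)) * M n (Suc (Suc k))"
  shows "has_jfraction (Abs_fps (\<lambda>n. M n 0)) s t"
proof -
  have zero_above_diagonal: "M n k = 0" if "n < k" for n k
    using that
  proof (induction n arbitrary: k)
    case 0
    then show ?case using M0 by (cases k) auto
  next
    case (Suc n)
    then show ?case by (cases k) (auto simp: step)
  qed
  define E where "E k = (case k of 0 \<Rightarrow> 1 | Suc j \<Rightarrow> Abs_fps (\<lambda>n. M (n + j) j))" for k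
  have E_Suc: "E (Suc k) $ n = M (n + k) k" for n k
    by (simp add: E_def)
  have "E (Suc k) = E k + fps_const (s k) * fps_X * E (Suc k)
      + fps_const (t (Suc k)) * fps_X ^ 2 * E (Suc (Suc k))" for k
  proof (rule fps_ext)
    fix n
    have *: "(fps_const c * fps_X * f) $ n = (if n = 0 then 0 else c * f $ (n - 1))"
      "(fps_const c * fps_X ^ 2 * f) $ n = (if n < 2 then 0 else c * f $ (n - 2))"
      for c and f :: "'a fps"
      by (simp_all add: mult.assoc fps_X_power_mult_nth)
    \<comment> \<open>The shifts by \<open>x\<close> and \<open>x\<^sup>2\<close> drop terms for \<open>n < 2\<close>; in the array recurrence the
      corresponding entries lie above the diagonal, hence vanish.\<close>
    consider "n = 0" | "n = 1" | m where "n = Suc (Suc m)"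
      by (metis One_nat_def not0_implies_Suc)
    then have "M (n + k) k = E k $ n + (if n = 0 then 0 else s k * M (n - 1 + k) k)
        + (if n < 2 then 0 else t (Suc k) * M (n - 2 + Suc k) (Suc k))"
    proof cases
      case 1
      show ?thesis using 1 M00 by (cases k) (simp_all add: E_def step zero_above_diagonal)
    next
      case 2
      show ?thesis using 2 by (cases k) (simp_all add: E_def step first zero_above_diagonal)
    next
      case 3
      show ?thesis using 3 by (cases k) (simp_all add: E_def step first)
    qed
    then show "E (Suc k) $ n = (E k + fps_const (s k) * fps_X * E (Suc k)
      + fps_const (t (Suc k)) * fps_X ^ 2 * E (Suc (Suc k))) $ n"
      by (simp only: fps_add_nth * E_Suc)
  qed
  then have "has_jfraction (E 1) s t"
    by (intro has_jfraction_three_term) (simp_all add: E_def)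
  then show ?thesis
    by (simp add: E_def)
qed

section \<open>Exponential Riordan arrays with tridiagonal production matrix\<close>

text \<open>
  The columns \<open>G W\<^sup>k / k!\<close> form an exponential Riordan array. Since
  \<open>C\<^sub>k' = (G'/G) C\<^sub>k + W' C\<^bsub>k-1\<^esub>\<close>, only the rule \<open>W C\<^sub>k = (k + 1) C\<^bsub>k+1\<^esub>\<close> is needed to turn powers
  of \<open>W\<close> into shifts of the column index: \<open>\<sigma>\<close> and \<open>\<alpha>\<close> contribute to level steps, \<open>\<gamma>\<close> and
  \<open>\<beta>\<close> to falls.
\<close>

lemma has_jfraction_riordan:
  fixes G W :: "'a::field_char_0 fps"
  assumes G0: "G $ 0 = 1" and W0: "W $ 0 = 0"
    and dG: "fps_deriv G = (fps_const \<sigma> + fps_const \<gamma> * W) * G"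
    and dW: "fps_deriv W = 1 + fps_const \<alpha> * W + fps_const \<beta> * W ^ 2"
    and s: "\<And>k. s k = \<sigma> + of_nat k * \<alpha>"
    and t: "\<And>k. t (Suc k) = of_nat (Suc k) * (\<gamma> + of_nat k * \<beta>)"
  shows "has_jfraction (Abs_fps (\<lambda>n. fact n * G $ n)) s t"
proof -
  define C where "C k = fps_const (1 / fact k) * (G * W ^ k)" for k
  define M where "M n k = fact n * C k $ n" for n k
  have fact_Suc: "fps_const (of_nat (Suc k)) * fps_const (1 / fact (Suc k)) = fps_const (1 / fact k :: 'a)" for k
    by (simp del: of_nat_Suc)
  have C_Suc: "fps_const (of_nat (Suc k)) * C (Suc k) = W * C k" for k
  proof -
    have "fps_const (of_nat (Suc k)) * C (Suc k)
        = (fps_const (of_nat (Suc k)) * fps_const (1 / fact (Suc k))) * (G * W ^ Suc k)"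
      unfolding C_def by (simp only: mult.assoc)
    then show ?thesis
      unfolding fact_Suc C_def by (simp only: power_Suc mult_ac)
  qed
  have C0: "C 0 = G"
    by (simp add: C_def)
  have dC0: "fps_deriv (C 0) = fps_const (s 0) * C 0 + fps_const (t 1) * C 1"
    using C_Suc[of 0] by (simp add: C0 dG s t distrib_right mult.assoc flip: fps_const_mult)
  have dC: "fps_deriv (C (Suc k)) = C k + fps_const (s (Suc k)) * C (Suc k)
      + fps_const (t (Suc (Suc k))) * C (Suc (Suc k))" for k
  proof -
    define N N' where "N = fps_const (of_nat (Suc k) :: 'a)"
      and "N' = fps_const (of_nat (Suc (Suc k)) :: 'a)"
    have N: "W * C k = N * C (Suc k)" and N': "W * C (Suc k) = N' * C (Suc (Suc k))"
      unfolding N_def N'_def by (simp_all only: C_Suc)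
    have "fps_deriv (W ^ Suc k) = N * (W ^ k * fps_deriv W)"
      by (simp only: fps_deriv_power' N_def fps_of_nat diff_Suc_1 mult_ac)
    then have "fps_deriv (C (Suc k)) = (fps_const \<sigma> + fps_const \<gamma> * W) * C (Suc k)
        + N * fps_const (1 / fact (Suc k)) * (G * W ^ k) * fps_deriv W"
      unfolding C_def fps_deriv_mult dG fps_deriv_const
      by (simp only: mult_zero_left mult_zero_right add_0_left add_0_right distrib_left distrib_right mult_ac add_ac)
    also have "N * fps_const (1 / fact (Suc k)) * (G * W ^ k) = C k"
      unfolding N_def fact_Suc C_def ..
    also have "C k * fps_deriv W = C k + fps_const \<alpha> * (W * C k) + fps_const \<beta> * (W * (W * C k))"
      unfolding dW by (simp add: algebra_simps power2_eq_square)
    also have "W * (W * C k) = N * (N' * C (Suc (Suc k)))"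
      by (simp only: N mult.left_commute N')
    finally have "fps_deriv (C (Suc k)) = C k + (fps_const \<sigma> + N * fps_const \<alpha>) * C (Suc k)
        + N' * (fps_const \<gamma> + N * fps_const \<beta>) * C (Suc (Suc k))"
      by (simp add: N N' distrib_right distrib_left mult.assoc)
    then show ?thesis
      by (simp only: s t N_def N'_def fps_const_add fps_const_mult)
  qed
  have M_Suc: "M (Suc n) k = fact n * fps_deriv (C k) $ n" for n k
    by (simp add: M_def)
  have "has_jfraction (Abs_fps (\<lambda>n. M n 0)) s t"
  proof (rule has_jfraction_array)
    show "M 0 0 = 1" by (simp add: M_def C_def G0)
    show "M 0 (Suc k) = 0" for k by (simp add: M_def C_def W0)
    show "M (Suc n) 0 = s 0 * M n 0 + t 1 * M n 1" for n
      unfolding M_Suc dC0 by (simp add: M_def algebra_simps)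
    show "M (Suc n) (Suc k)
      = M n k + s (Suc k) * M n (Suc k) + t (Suc (Suc k)) * M n (Suc (Suc k))" for n k
      unfolding M_Suc dC by (simp add: M_def algebra_simps)
  qed
  then show ?thesis
    by (simp add: M_def C0)
qed

section \<open>Differential equations for the generating function\<close>

lemma fps_real_power_nth_0: "fps_real_power F b $ 0 = 1"
  by (simp add: fps_real_power_def fps_compose_nth_0)

text \<open>
  The logarithm of \<open>F\<close> has derivative \<open>F'/F = L\<close>, so the power multiplies the logarithmic
  derivative by the exponent. With the constant term 1 this determines the power.
\<close>

lemma fps_deriv_real_power:
  assumes "F $ 0 = 1" and "fps_deriv F = L * F"
  shows "fps_deriv (fps_real_power F b) = fps_const (ratfun_const b) * L * fps_real_power F b"
proof -
  define Y where "Y = fps_const (ratfun_const b) * (fps_ln 1 oo (F - 1))"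
  have "inverse (1 + fps_X) oo (F - 1) = inverse F"
    using assms(1) by (subst fps_inverse_compose) (simp_all add: fps_compose_add_distrib)
  then have "fps_deriv (fps_ln 1 oo (F - 1)) = inverse F * (L * F)"
    using assms by (simp add: fps_compose_deriv fps_ln_deriv)
  also have "\<dots> = L"
    using inverse_mult_eq_1[of F] assms(1) by (simp add: mult.left_commute)
  finally have dY: "fps_deriv Y = fps_const (ratfun_const b) * L"
    by (simp add: Y_def)
  have "Y $ 0 = 0"
    by (simp add: Y_def fps_ln_def)
  then have "fps_deriv (fps_exp 1 oo Y) = (fps_exp 1 oo Y) * fps_deriv Y"
    by (simp add: fps_compose_deriv)
  then show ?thesis
    by (simp add: fps_real_power_def Y_def[symmetric] dY mult.commute)
qed

text \<open>
  With \<open>E = e\<^bsup>d(1-q)x\<^esup>\<close> the natural choice is \<open>W = (E - 1) / (d (1 - q E))\<close>, which makes no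
  sense for \<open>d = 0\<close>. Defining \<open>W\<close> as the integral of the derivative
  \<open>(1 - q)\<^sup>2 E / (1 - q E)\<^sup>2\<close> of that quotient covers every \<open>d\<close>, and
  \<open>d W = (E - 1) / (1 - q E)\<close> is recovered by comparing derivatives. It gives
  \<open>1 + d W = (1 - q) E / (1 - q E)\<close> and \<open>1 + d q W = (1 - q) / (1 - q E)\<close>, whose product
  is \<open>W'\<close>.
\<close>

lemma log_deriv_base_affine:
  fixes a d q :: "'a::field_char_0"
  assumes "q \<noteq> 1"
  defines "F \<equiv> fps_const (1 - q) * fps_exp (a * (1 - q)) / (1 - fps_const q * fps_exp (d * (1 - q)))"
  obtains W where "F $ 0 = 1" and "W $ 0 = 0"
    and "fps_deriv W = 1 + fps_const (d * (1 + q)) * W + fps_const (d ^ 2 * q) * W ^ 2"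
    and "fps_deriv F = (fps_const (a * (1 - q) + d * q) + fps_const (d ^ 2 * q) * W) * F"
proof -
  define E where "E = fps_exp (d * (1 - q))"
  define A where "A = fps_exp (a * (1 - q))"
  define H where "H = inverse (1 - fps_const q * E)"
  define c where "c = fps_const q"
  define D where "D = fps_const d"
  define W where "W = fps_integral0 ((1 - c) ^ 2 * E * H ^ 2)"
  have E0: "(1 - fps_const q * E) $ 0 \<noteq> 0"
    using assms by (simp add: E_def)
  have const: "fps_const (1 - q) = 1 - c"
    by (simp add: c_def)
  have H1: "H * (1 - c * E) = 1"
    using inverse_mult_eq_1[OF E0] by (simp add: H_def c_def)
  have dc: "fps_deriv c = 0"
    by (simp add: c_def)
  have dE: "fps_deriv E = D * (1 - c) * E"
    by (simp add: E_def D_def const[symmetric])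
  have dA: "fps_deriv A = fps_const a * (1 - c) * A"
    by (simp add: A_def const[symmetric])
  have dH: "fps_deriv H = c * D * (1 - c) * E * H ^ 2"
    unfolding H_def using fps_inverse_deriv[OF E0] by (simp add: c_def dE)
  have dW: "fps_deriv W = (1 - c) ^ 2 * E * H ^ 2"
    by (simp add: W_def fps_deriv_fps_integral)
  have W0: "W $ 0 = 0"
    by (simp add: W_def fps_integral_def)
  have "fps_deriv ((E - 1) * H) = D * (1 - c) * E * H * (H * (1 - c * E))
      + c * D * (1 - c) * E * H ^ 2 * (E - 1)"
    unfolding H1 by (simp add: dE dH algebra_simps)
  also have "\<dots> = D * ((1 - c) ^ 2 * E * H ^ 2)"
    by (simp add: algebra_simps power2_eq_square)
  also have "\<dots> = fps_deriv (D * W)"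
    by (simp add: dW D_def)
  finally have "(E - 1) * H = D * W"
    unfolding fps_deriv_eq_iff by (simp add: W0 E_def)
  then have "1 + D * W = H * (1 - c * E) + (E - 1) * H"
    and "1 + c * D * W = H * (1 - c * E) + c * ((E - 1) * H)"
    by (simp_all only: H1 mult.assoc)
  then have L1: "1 + D * W = (1 - c) * E * H" and L2: "1 + c * D * W = (1 - c) * H"
    by (simp_all add: algebra_simps)
  have F: "F = (1 - c) * A * H"
    using E0 by (simp add: F_def A_def H_def E_def const[symmetric] fps_divide_unit)
  show ?thesis
  proof
    show "F $ 0 = 1"
      using assms by (simp add: F c_def A_def H_def E_def)
    show "W $ 0 = 0" by fact
    show "fps_deriv W = 1 + fps_const (d * (1 + q)) * W + fps_const (d ^ 2 * q) * W ^ 2"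
    proof -
      have "fps_deriv W = (1 + D * W) * (1 + c * D * W)"
        unfolding dW L1 L2 by (simp add: algebra_simps power2_eq_square)
      then show ?thesis
        by (simp add: D_def c_def algebra_simps power2_eq_square flip: fps_const_add fps_const_mult)
    qed
    show "fps_deriv F = (fps_const (a * (1 - q) + d * q) + fps_const (d ^ 2 * q) * W) * F"
    proof -
      have "fps_deriv F = (fps_const a * (1 - c) + c * D * ((1 - c) * E * H)) * F"
        by (simp add: F dA dH dc) (simp add: algebra_simps power2_eq_square)
      also have "\<dots> = (fps_const a * (1 - c) + c * D * (1 + D * W)) * F"
        unfolding L1 ..
      finally show ?thesis
        by (simp add: D_def c_def algebra_simps power2_eq_square
          flip: fps_const_add fps_const_mult fps_const_sub)
    qed
  qed
qed

section \<open>The continued fraction\<close>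

lemma to_fract_affine:
  "to_fract [:u, v:] = ratfun_const u + ratfun_const v * ratfun_q"
  by (simp add: ratfun_const_def ratfun_q_def flip: to_fract_add to_fract_mult)

text \<open>
  The constants are a ring embedding of the reals, which moves the coefficients of the
  polynomials \<open>s\<close> and \<open>t\<close> into the field of rational functions.
\<close>

lemma ratfun_const_simps:
  "ratfun_const (u + v) = ratfun_const u + ratfun_const v"
  "ratfun_const (u - v) = ratfun_const u - ratfun_const v"
  "ratfun_const (u * v) = ratfun_const u * ratfun_const v"
  "ratfun_const (real n) = of_nat n"
  "ratfun_const 0 = 0"
  "ratfun_const 1 = 1"
proof -
  show sum: "ratfun_const (u + v) = ratfun_const u + ratfun_const v" for u v
    by (simp add: ratfun_const_def flip: to_fract_add)
  show one: "ratfun_const 1 = 1"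
    by (simp add: ratfun_const_def flip: one_pCons)
  show zero: "ratfun_const 0 = 0"
    by (simp add: ratfun_const_def)
  show "ratfun_const (real n) = of_nat n"
    by (induction n) (simp_all add: zero one sum)
qed (simp_all add: ratfun_const_def flip: to_fract_diff to_fract_mult)

theorem theorem2p1:
  fixes a b d :: real
    and T s t :: "nat \<Rightarrow> real poly"
  assumes egf: "Abs_fps (\<lambda>n. to_fract (T n) / fact n) =
      fps_real_power
        (fps_const (1 - ratfun_q) * fps_exp (ratfun_const a * (1 - ratfun_q)) /
          (1 - fps_const ratfun_q * fps_exp (ratfun_const d * (1 - ratfun_q)))) b"
    and s: "\<And>i. s i = [:d * real i + a * b, d * real i + b * d - a * b:]"
    and t: "\<And>i. t (i + 1) = [:0, d ^ 2 * (real i + 1) * (real i + b):]"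
  shows "has_jfraction (Abs_fps (\<lambda>n. to_fract (T n)))
    (\<lambda>i. to_fract (s i)) (\<lambda>i. to_fract (t i))"
proof -
  let ?a = "ratfun_const a" and ?b = "ratfun_const b" and ?d = "ratfun_const d"
  let ?q = ratfun_q
  let ?F = "fps_const (1 - ?q) * fps_exp (?a * (1 - ?q)) / (1 - fps_const ?q * fps_exp (?d * (1 - ?q)))"
  have "?q \<noteq> 1"
    by (simp add: ratfun_q_def one_pCons flip: to_fract_1)
  then obtain W where F0: "?F $ 0 = 1" and W0: "W $ 0 = 0"
    and dW: "fps_deriv W = 1 + fps_const (?d * (1 + ?q)) * W + fps_const (?d ^ 2 * ?q) * W ^ 2"
    and dF: "fps_deriv ?F = (fps_const (?a * (1 - ?q) + ?d * ?q) + fps_const (?d ^ 2 * ?q) * W) * ?F"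
    by (rule log_deriv_base_affine)
  define G where "G = fps_real_power ?F b"
  have G0: "G $ 0 = 1"
    unfolding G_def by (rule fps_real_power_nth_0)
  have dG: "fps_deriv G = (fps_const (?b * (?a * (1 - ?q) + ?d * ?q))
      + fps_const (?b * ?d ^ 2 * ?q) * W) * G"
    unfolding G_def fps_deriv_real_power[OF F0 dF]
    by (simp add: ring_distribs mult.assoc flip: fps_const_mult fps_const_add)
  have "has_jfraction (Abs_fps (\<lambda>n. fact n * G $ n))
      (\<lambda>i. to_fract (s i)) (\<lambda>i. to_fract (t i))"
  proof (rule has_jfraction_riordan[OF G0 W0 dG dW])
    show "to_fract (s k) = ?b * (?a * (1 - ?q) + ?d * ?q) + of_nat k * (?d * (1 + ?q))" for k
      unfolding s to_fract_affine ratfun_const_simps by (simp add: algebra_simps)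
    show "to_fract (t (Suc k)) = of_nat (Suc k) * (?b * ?d ^ 2 * ?q + of_nat k * (?d ^ 2 * ?q))"
      for k
      using t[of k] unfolding Suc_eq_plus1
      by (simp only: to_fract_affine ratfun_const_simps power2_eq_square of_nat_add of_nat_1)
         (simp add: algebra_simps)
  qed
  moreover have "fact n * G $ n = to_fract (T n)" for n
    unfolding G_def egf[symmetric] by simp
  ultimately show ?thesis
    by simp
qed

end
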